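(* Let $(Y_t)_{t\ge0}$ be a subordinator with $Y_0=0$, $Y_t\in(0,\infty)$ for $t>0$, and Laplace exponent $\Phi$, i.e. $\mathbb{E}(\mathrm{e}^{-uY_t})=\mathrm{e}^{-t\Phi(u)}$. Suppose that $L:(0,\infty)\to(-\infty,\infty)$ is decreasing with $\lim_{y\to0}L(y)=\infty$ and that $L$ is slowly varying at zero, and let $L^{-1}$ be its inverse function. Let $X^\ast$ be a random variable which is not concentrated at one point, with distribution function $H^\ast(u)=\mathbb{P}(X^\ast\le u)$, and let $\gamma>0$. Let $\mathcal{E}_\gamma$ be a random variable with exponential distribution function $E_\gamma(x)=1-\mathrm{e}^{-\gamma x}$, $x\ge0$. Then the following statements are equivalent: (1) $t\,L(Y_t)\to X^\ast$ in distribution as $t\to0$; (2) $t\,L(Y_t)\to\mathcal{E}_\gamma$ in distribution as $t\to0$; (3) $\Phi(1/s)/L(s)\to\gamma$ as $s\to0$; (4) $t\,\Phi\bigl(1/L^{-1}(u/t)\bigr)\to-\log(1-H^\ast(u))$ as $t\to0$, for all continuity points $u$ of $H^\ast$.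
   Context: A subordinator is an increasing Lévy process $(Y_t)_{t\ge0}$ with $Y_0=0$. A function $L$ is slowly varying at zero if $\lim_{x\to0}L(\lambda x)/L(x)=1$ for all $\lambda>0$. Put $L(\infty)=\lim_{y\to\infty}L(y)\in[-\infty,\infty)$. $L^{-1}:(-\infty,\infty)\to(0,\infty)$ denotes the (decreasing) inverse function of $L$, with the convention that $L^{-1}(x)=\infty$ for $x\le L(\infty)$, in which case $1/L^{-1}(x)=0$. Limits $t\to0$, $s\to0$, $y\to0$ and $x\to0$ are from the right, and $-\log0=\infty$.
   Formalization: X* and γ cannot be chosen independently (X* ~ Exp(1), γ = 2 refutes (1)⇒(2)); proved instead: (1) iff X* has the law of E_γ for some γ > 0 with (2), likewise with (3); (1) iff (4) for every X*; (2) iff (3) for every γ > 0. *)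

theory Defs
  imports "HOL-Probability.Probability"
begin

text \<open>A process is a map \<open>Y t \<omega>\<close> that matters only for \<open>t \<ge> 0\<close>. Stochastic continuity is
  not listed: it follows from stationarity of the increments and the cadlag paths.\<close>

locale levy_process = prob_space M for M :: "'a measure" +
  fixes Y :: "real \<Rightarrow> 'a \<Rightarrow> real"
  assumes random_variable_at: "0 \<le> t \<Longrightarrow> Y t \<in> borel_measurable M"
    and start_zero: "AE \<omega> in M. Y 0 \<omega> = 0"
    and independent_increments:
      "0 \<le> \<tau> 0 \<Longrightarrow> (\<And>i. i < n \<Longrightarrow> \<tau> i \<le> \<tau> (Suc i)) \<Longrightarrow>
        indep_vars (\<lambda>_. borel) (\<lambda>i \<omega>. Y (\<tau> (Suc i)) \<omega> - Y (\<tau> i) \<omega>) {..<n::nat}"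
    and stationary_increments:
      "0 \<le> s \<Longrightarrow> 0 \<le> h \<Longrightarrow> distr M borel (\<lambda>\<omega>. Y (s + h) \<omega> - Y s \<omega>) = distr M borel (Y h)"
    and cadlag_paths:
      "AE \<omega> in M. \<forall>t\<ge>0. ((\<lambda>s. Y s \<omega>) \<longlongrightarrow> Y t \<omega>) (at_right t) \<and>
        (0 < t \<longrightarrow> (\<exists>l. ((\<lambda>s. Y s \<omega>) \<longlongrightarrow> l) (at_left t)))"

locale subordinator = levy_process +
  assumes increasing_paths: "AE \<omega> in M. mono_on {0..} (\<lambda>t. Y t \<omega>)"

definition laplace_exponent :: "'a measure \<Rightarrow> (real \<Rightarrow> 'a \<Rightarrow> real) \<Rightarrow> (real \<Rightarrow> real) \<Rightarrow> bool" where
  "laplace_exponent M Y \<Phi> \<longleftrightarrow>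
    (\<forall>t\<ge>0. \<forall>u\<ge>0. (\<integral>\<omega>. exp (- u * Y t \<omega>) \<partial>M) = exp (- t * \<Phi> u))"

definition slowly_varying_at_zero :: "(real \<Rightarrow> real) \<Rightarrow> bool" where
  "slowly_varying_at_zero L \<longleftrightarrow>
    (\<forall>c>0. ((\<lambda>x. L (c * x) / L x) \<longlongrightarrow> 1) (at_right 0))"

text \<open>The inverse of a decreasing \<open>L\<close> on \<open>(0, \<infinity>)\<close>, with value \<open>\<infinity>\<close> at and below the limit
  \<open>L(\<infinity>)\<close>. Above \<open>L(\<infinity>)\<close> it is the generalised inverse, so that \<open>L\<close> may have jumps and flat
  pieces; the two lemmas show that it is the inverse function when \<open>L\<close> has one.\<close>

definition at_infty :: "(real \<Rightarrow> real) \<Rightarrow> ereal" where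
  "at_infty L = Lim at_top (\<lambda>y. ereal (L y))"

definition decr_inverse :: "(real \<Rightarrow> real) \<Rightarrow> real \<Rightarrow> ereal" where
  "decr_inverse L x = (if ereal x \<le> at_infty L then \<infinity> else ereal (Inf {y. 0 < y \<and> L y \<le> x}))"

lemma at_infty_le:
  assumes "antimono_on {0<..} L" "0 < y"
  shows "at_infty L \<le> ereal (L y)"
proof -
  let ?I = "INF z\<in>{0<..}. ereal (L z)"
  have "((\<lambda>z. ereal (L z)) \<longlongrightarrow> ?I) at_top"
  proof (rule decreasing_tendsto)
    show "eventually (\<lambda>z. ?I \<le> ereal (L z)) at_top"
      using eventually_gt_at_top[of 0] by eventually_elim (auto intro: INF_lower)
  next
    fix x assume "?I < x"
    then obtain z where z: "0 < z" "ereal (L z) < x" by (auto simp: INF_less_iff)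
    show "eventually (\<lambda>w. ereal (L w) < x) at_top"
      using eventually_ge_at_top[of z]
    proof eventually_elim
      case (elim w)
      then have "L w \<le> L z" using monotone_onD[OF assms(1), of z w] z(1) by simp
      then show ?case using z(2) by (meson ereal_less_eq(3) order.strict_trans1)
    qed
  qed
  then have "at_infty L = ?I" unfolding at_infty_def by (intro tendsto_Lim) auto
  then show ?thesis using assms(2) by (auto intro: INF_lower)
qed

lemma decr_inverse_eq:
  assumes L: "strict_antimono_on {0<..} L" and y: "0 < y"
  shows "decr_inverse L (L y) = ereal y"
proof -
  have anti: "antimono_on {0<..} L"
    using L by (simp add: strict_antimono_iff_antimono)
  have "at_infty L \<le> ereal (L (y + 1))" using at_infty_le[OF anti] y by simp
  also have "\<dots> < ereal (L y)" using monotone_onD[OF L, of y "y + 1"] y by simp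
  finally have 1: "\<not> ereal (L y) \<le> at_infty L" by simp
  have "{z. 0 < z \<and> L z \<le> L y} = {y..}"
  proof safe
    fix z assume "0 < z" "L z \<le> L y"
    then show "y \<le> z" using monotone_onD[OF L, of z y] y by (cases "y \<le> z") auto
  next
    fix z assume z: "y \<le> z"
    then show "0 < z" using y by simp
    then show "L z \<le> L y" using monotone_onD[OF anti, of y z] y z by simp
  qed
  then show ?thesis using 1 by (simp add: decr_inverse_def)
qed

lemma L_decr_inverse:
  assumes L: "strict_antimono_on {0<..} L" and x: "x \<in> L ` {0<..}"
  shows "L (real_of_ereal (decr_inverse L x)) = x"
  using x decr_inverse_eq[OF L] by auto

text \<open>Convergence in distribution along a filter; for \<open>sequentially\<close> this is
  \<open>weak_conv_m\<close> applied to the laws.\<close>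

definition converges_in_distribution ::
    "'a measure \<Rightarrow> ('i \<Rightarrow> 'a \<Rightarrow> real) \<Rightarrow> real measure \<Rightarrow> 'i filter \<Rightarrow> bool" where
  "converges_in_distribution M Z \<mu> F \<longleftrightarrow>
    (\<forall>x. isCont (cdf \<mu>) x \<longrightarrow> ((\<lambda>i. cdf (distr M borel (Z i)) x) \<longlongrightarrow> cdf \<mu> x) F)"

definition exponential_law :: "real \<Rightarrow> real measure" where
  "exponential_law \<gamma> = density lborel (exponential_density \<gamma>)"

lemma cdf_exponential_law:
  assumes "0 < \<gamma>" "0 \<le> x"
  shows "cdf (exponential_law \<gamma>) x = 1 - exp (- \<gamma> * x)"
proof -
  have "emeasure (exponential_law \<gamma>) {..x} = ennreal (1 - exp (- \<gamma> * x))"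
    unfolding exponential_law_def using assms emeasure_erlang_density[of \<gamma> 0 x]
    by (simp add: erlang_CDF_def mult.commute)
  then show ?thesis using assms by (simp add: cdf_def measure_def)
qed

definition neg_log :: "real \<Rightarrow> ereal" where
  "neg_log p = (if p = 0 then \<infinity> else ereal (- ln p))"

end

theory Submission
  imports Defs
begin

text \<open>With \<open>s = L\<^sup>-\<^sup>1(u/t)\<close> the Laplace transform \<open>E exp (- Y\<^sub>t / s) = exp (- t \<Phi>(1/s))\<close> is a smoothed
  version of \<open>P(Y\<^sub>t < s)\<close>, that is, of \<open>P(t L(Y\<^sub>t) > u)\<close>. The smoothing only blurs \<open>s\<close> by a
  constant factor, and slow variation gives \<open>t L(c s) \<longlongrightarrow> u\<close> for all \<open>c > 0\<close>; so the two quantities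
  have the same limits at continuity points, for any limit law whatsoever. Since the transform equals
  \<open>exp (- u f(u/t))\<close> with \<open>f(x) = \<Phi>(1/L\<^sup>-\<^sup>1(x)) / x\<close>, convergence at one point \<open>u\<close> with
  \<open>0 < H(u) < 1\<close> forces \<open>f\<close> to converge to a constant \<open>\<gamma>\<close>, whence \<open>1 - H(u) = exp (- \<gamma> u)\<close> for
  all \<open>u > 0\<close>; and \<open>f \<longlongrightarrow> \<gamma>\<close> is a reparametrisation of \<open>\<Phi>(1/s) / L(s) \<longlongrightarrow> \<gamma>\<close>.\<close>

section \<open>Inverses of slowly varying functions\<close>

text \<open>Meaningful only above the limit of \<open>L\<close> at infinity; the set may be empty below it.\<close>

definition ginv :: "(real \<Rightarrow> real) \<Rightarrow> real \<Rightarrow> real" where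
  "ginv L x = Inf {y. 0 < y \<and> L y \<le> x}"

text \<open>\<open>\<Phi>\<close> takes real arguments, so the extended-real quotient is converted
  back. Where \<open>decr_inverse L x\<close> is infinite the value is 0, in line with the
  convention 1/\<infinity> = 0.\<close>

definition recip_inverse :: "(real \<Rightarrow> real) \<Rightarrow> real \<Rightarrow> real" where
  "recip_inverse L x = real_of_ereal (1 / decr_inverse L x)"

lemma ginv_le: "0 < y \<Longrightarrow> L y \<le> x \<Longrightarrow> ginv L x \<le> y"
  unfolding ginv_def by (rule cInf_lower) (auto intro!: bdd_belowI[of _ 0])

text \<open>By monotonicity \<open>at_infty L\<close> is the infimum of \<open>L\<close> on the
  positive half-line, so a level above it is not a lower bound. This makes the set in
  \<open>ginv\<close> nonempty.\<close>

lemma ex_le_if_at_infty_less: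
  assumes "antimono_on {0<..} L" "at_infty L < ereal x"
  shows "\<exists>y>0. L y \<le> x"
proof (rule ccontr)
  assume "\<not> (\<exists>y>0. L y \<le> x)"
  then have gt: "x < L y" if "0 < y" for y using that by (meson not_le)
  let ?I = "INF z\<in>{0<..}. ereal (L z)"
  have "((\<lambda>z. ereal (L z)) \<longlongrightarrow> ?I) at_top"
  proof (rule decreasing_tendsto)
    show "eventually (\<lambda>z. ?I \<le> ereal (L z)) at_top"
      using eventually_gt_at_top[of 0] by eventually_elim (auto intro: INF_lower)
  next
    fix w assume "?I < w"
    then obtain z where z: "0 < z" "ereal (L z) < w" by (auto simp: INF_less_iff)
    show "eventually (\<lambda>y. ereal (L y) < w) at_top"
      using eventually_ge_at_top[of z]
    proof eventually_elim
      case (elim y)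
      then have "L y \<le> L z" using monotone_onD[OF assms(1), of z y] z(1) by simp
      then show ?case using z(2) by (meson ereal_less_eq(3) order.strict_trans1)
    qed
  qed
  then have "at_infty L = ?I" unfolding at_infty_def by (intro tendsto_Lim) auto
  moreover have "ereal x \<le> ?I" using gt by (intro INF_greatest) (auto intro: less_imp_le)
  ultimately show False using assms(2) by simp
qed

text \<open>Removes extended reals from the fourth statement. The case p = 0 is divergence of
  \<open>f\<close> to \<infinity>; for p > 0 it is continuity of \<open>exp\<close> and of
  \<open>ln\<close> at p.\<close>

lemma exp_neg_tendsto_iff:
  fixes f :: "'i \<Rightarrow> real"
  assumes "0 \<le> p"
  shows "((\<lambda>i. ereal (f i)) \<longlongrightarrow> neg_log p) F \<longleftrightarrow> ((\<lambda>i. exp (- f i)) \<longlongrightarrow> p) F"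
proof (cases "p = 0")
  case True
  have "filterlim f at_top F \<longleftrightarrow> ((\<lambda>i. exp (- f i)) \<longlongrightarrow> 0) F"
  proof
    assume "filterlim f at_top F"
    then show "((\<lambda>i. exp (- f i)) \<longlongrightarrow> 0) F"
      by (intro filterlim_compose[OF exp_at_bot]) (simp add: filterlim_uminus_at_bot)
  next
    assume l: "((\<lambda>i. exp (- f i)) \<longlongrightarrow> 0) F"
    show "filterlim f at_top F"
      unfolding filterlim_at_top
    proof
      fix Z
      have "eventually (\<lambda>i. exp (- f i) < exp (- Z)) F" by (rule order_tendstoD(2)[OF l]) simp
      then show "eventually (\<lambda>i. Z \<le> f i) F" by eventually_elim simp
    qed
  qed
  then show ?thesis using True by (simp add: neg_log_def tendsto_PInfty_eq_at_top)
next
  case False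
  then have p: "0 < p" using assms by simp
  have "(f \<longlongrightarrow> - ln p) F \<longleftrightarrow> ((\<lambda>i. exp (- f i)) \<longlongrightarrow> p) F"
  proof
    assume "(f \<longlongrightarrow> - ln p) F"
    then have "((\<lambda>i. exp (- f i)) \<longlongrightarrow> exp (- (- ln p))) F" by (intro tendsto_intros)
    then show "((\<lambda>i. exp (- f i)) \<longlongrightarrow> p) F" using p by simp
  next
    assume "((\<lambda>i. exp (- f i)) \<longlongrightarrow> p) F"
    then have "((\<lambda>i. - ln (exp (- f i))) \<longlongrightarrow> - ln p) F" using False by (intro tendsto_intros)
    then show "(f \<longlongrightarrow> - ln p) F" by simp
  qed
  then show ?thesis using False by (simp add: neg_log_def)
qed

locale decr_slowly_varying =
  fixes L :: "real \<Rightarrow> real"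
  assumes antimono: "antimono_on {0<..} L"
    and at_top_at_zero: "filterlim L at_top (at_right 0)"
    and slowly_varying: "slowly_varying_at_zero L"
begin

lemma L_le: "0 < x \<Longrightarrow> x \<le> y \<Longrightarrow> L y \<le> L x"
  using monotone_onD[OF antimono, of x y] by simp

lemma ex_pos_near_zero: "\<exists>\<delta>>0. \<forall>y. 0 < y \<and> y < \<delta> \<longrightarrow> x < L y"
  using filterlim_at_top_dense[THEN iffD1, OF at_top_at_zero, rule_format, of x]
  by (auto simp: eventually_at_right_field)

lemma le_ginv:
  assumes x: "at_infty L < ereal x" and "0 < d" and d: "\<And>y. 0 < y \<Longrightarrow> y < d \<Longrightarrow> x < L y"
  shows "d \<le> ginv L x"
  unfolding ginv_def
proof (rule cInf_greatest)
  show "{y. 0 < y \<and> L y \<le> x} \<noteq> {}" using ex_le_if_at_infty_less[OF antimono x] by auto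
  show "d \<le> y" if "y \<in> {y. 0 < y \<and> L y \<le> x}" for y using d[of y] that by (auto simp: not_le[symmetric])
qed

lemma ginv_pos:
  assumes x: "at_infty L < ereal x" shows "0 < ginv L x"
proof -
  obtain d where "d>0" "\<forall>y. 0 < y \<and> y < d \<longrightarrow> x < L y" using ex_pos_near_zero by blast
  then show ?thesis using le_ginv[OF x, of d] by fastforce
qed

text \<open>Since \<open>L\<close> may jump at \<open>ginv L x\<close>, its value there can lie on
  either side of \<open>x\<close>. Only points strictly below (here) and strictly above (next lemma)
  are controlled.\<close>

lemma less_L_if_less_ginv: "0 < y \<Longrightarrow> y < ginv L x \<Longrightarrow> x < L y"
  using ginv_le[of y L x] by (auto simp: not_le[symmetric])

lemma L_le_if_ginv_less:
  assumes "at_infty L < ereal x" "ginv L x < y"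
  shows "L y \<le> x"
proof -
  have "{y. 0 < y \<and> L y \<le> x} \<noteq> {}" using ex_le_if_at_infty_less[OF antimono assms(1)] by auto
  from cInf_lessD[OF this assms(2)[unfolded ginv_def]]
  obtain z where "0 < z" "L z \<le> x" "z < y" by blast
  then show ?thesis using L_le[of z y] by simp
qed

lemma recip_inverse_eq: "at_infty L < ereal x \<Longrightarrow> recip_inverse L x = 1 / ginv L x"
  using ginv_pos[of x] by (simp add: recip_inverse_def decr_inverse_def ginv_def one_ereal_def)

lemma recip_inverse_eq_0: "ereal x \<le> at_infty L \<Longrightarrow> recip_inverse L x = 0"
  by (simp add: recip_inverse_def decr_inverse_def)

lemma recip_inverse_nonneg: "0 \<le> recip_inverse L x"
proof (cases "at_infty L < ereal x")
  case True
  then show ?thesis using ginv_pos[of x] by (simp add: recip_inverse_eq)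
qed (simp add: recip_inverse_eq_0)

text \<open>\<open>L\<close> is positive on some interval (0, d), so the inverse at a level \<le> 0
  is at least d or infinite. This serves the levels u / t with u \<le> 0.\<close>

lemma recip_inverse_bounded: "\<exists>r. \<forall>x\<le>0. recip_inverse L x \<le> r"
proof -
  obtain d where d: "d>0" "\<forall>y. 0 < y \<and> y < d \<longrightarrow> 0 < L y" using ex_pos_near_zero by blast
  have "recip_inverse L x \<le> 1 / d" if "x \<le> 0" for x
  proof (cases "at_infty L < ereal x")
    case True
    then have "d \<le> ginv L x" using d that by (intro le_ginv) fastforce+
    then show ?thesis using d ginv_pos[OF True] by (simp add: recip_inverse_eq True frac_le)
  qed (use d in \<open>simp add: recip_inverse_eq_0\<close>)
  then show ?thesis by blast
qed

lemma eventually_at_infty_less: "eventually (\<lambda>x. at_infty L < ereal x) at_top"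
  using eventually_gt_at_top[of "L 1"]
proof eventually_elim
  case (elim x)
  then show ?case using at_infty_le[OF antimono, of 1] by (meson less_ereal.simps(1) order.strict_trans1 zero_less_one)
qed

lemma ginv_tendsto_0: "filterlim (ginv L) (at_right 0) at_top"
  unfolding filterlim_at
proof
  show "eventually (\<lambda>x. ginv L x \<in> {0<..} \<and> ginv L x \<noteq> 0) at_top"
    using eventually_at_infty_less by eventually_elim (use ginv_pos in force)
  show "(ginv L \<longlongrightarrow> 0) at_top"
  proof (rule order_tendstoI)
    fix a :: real assume "a < 0"
    with eventually_at_infty_less show "eventually (\<lambda>x. a < ginv L x) at_top"
      by (auto elim!: eventually_mono dest: ginv_pos)
  next
    fix a :: real assume "0 < a"
    show "eventually (\<lambda>x. ginv L x < a) at_top"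
      \<comment> \<open>Half of \<open>a\<close>, because \<open>ginv_le\<close> only yields a
        non-strict bound.\<close>
      using eventually_ge_at_top[of "L (a / 2)"]
    proof eventually_elim
      case (elim x)
      then show ?case using ginv_le[of "a / 2" L x] \<open>0 < a\<close> by simp
    qed
  qed
qed

lemma L_ratio_tendsto:
  assumes "0 < a" "0 < b"
  shows "((\<lambda>s. L (a * s) / L (b * s)) \<longlongrightarrow> 1) (at_right 0)"
proof -
  have *: "((\<lambda>s. L (c * s) / L s) \<longlongrightarrow> 1) (at_right 0)" if "0 < c" for c
    using slowly_varying that unfolding slowly_varying_at_zero_def by simp
  have "((\<lambda>s. (L (a * s) / L s) / (L (b * s) / L s)) \<longlongrightarrow> 1 / 1) (at_right 0)"
    using assms by (intro tendsto_divide *) auto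
  moreover have "eventually (\<lambda>s. (L (a * s) / L s) / (L (b * s) / L s) = L (a * s) / L (b * s)) (at_right 0)"
    using filterlim_at_top_dense[THEN iffD1, OF at_top_at_zero, rule_format, of 0]
    by eventually_elim simp
  ultimately show ?thesis unfolding div_by_1 by (rule Lim_transform_eventually)
qed

text \<open>For s = \<open>ginv L x\<close> one has L(2s) \<le> x < L(s/2), whatever
  \<open>L\<close> does at s itself. By slow variation both bounds are asymptotically equivalent to
  L(cs), so dividing gives the sandwich.\<close>

lemma L_ginv_asymp:
  assumes "0 < c"
  shows "((\<lambda>x. L (c * ginv L x) / x) \<longlongrightarrow> 1) at_top"
proof (rule tendsto_sandwich)
  note g = ginv_tendsto_0
  show "((\<lambda>x. L (c * ginv L x) / L (1/2 * ginv L x)) \<longlongrightarrow> 1) at_top"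
    by (rule filterlim_compose[OF L_ratio_tendsto g]) (use assms in auto)
  show "((\<lambda>x. L (c * ginv L x) / L (2 * ginv L x)) \<longlongrightarrow> 1) at_top"
    by (rule filterlim_compose[OF L_ratio_tendsto g]) (use assms in auto)
  have pos: "eventually (\<lambda>x. 0 < L (a * ginv L x)) at_top" if "0 < a" for a
  proof -
    have "filterlim (\<lambda>s. a * s) (at_right 0) (at_right 0)"
      using that by (intro filterlim_times_pos[where c=a and p=0 and l=0]) (auto intro!: filterlim_ident)
    then have "filterlim (\<lambda>x. L (a * ginv L x)) at_top at_top"
      using filterlim_compose[OF at_top_at_zero filterlim_compose[OF _ g]] by blast
    then show ?thesis unfolding filterlim_at_top_dense by blast
  qed
  note ev = eventually_at_infty_less eventually_gt_at_top[of 0] pos[of c, OF assms] pos[of 2, simplified]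
  show "eventually (\<lambda>x. L (c * ginv L x) / L (1/2 * ginv L x) \<le> L (c * ginv L x) / x) at_top"
    using ev
  proof eventually_elim
    case (elim x)
    then have "x < L (1/2 * ginv L x)" using ginv_pos[of x] by (intro less_L_if_less_ginv) auto
    then show ?case using elim by (intro divide_left_mono) auto
  qed
  show "eventually (\<lambda>x. L (c * ginv L x) / x \<le> L (c * ginv L x) / L (2 * ginv L x)) at_top"
    using ev
  proof eventually_elim
    case (elim x)
    then have "L (2 * ginv L x) \<le> x" using ginv_pos[of x] by (intro L_le_if_ginv_less) auto
    then show ?case using elim by (intro divide_left_mono) auto
  qed
qed

end

section \<open>Distribution functions and their continuity points\<close>

context real_distribution
begin

text \<open>Discontinuities are atoms. There are only countably many of these, whereas an open
  interval is uncountable.\<close>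

lemma ex_isCont_cdf_between:
  assumes "a < b"
  shows "\<exists>x. a < x \<and> x < b \<and> isCont (cdf M) x"
proof (rule ccontr)
  assume "\<not> ?thesis"
  then have "{a<..<b} \<subseteq> {x. measure M {x} > 0}"
    by (auto simp: isCont_cdf zero_less_measure_iff)
  then have "countable {a<..<b}" using countable_atoms countable_subset by blast
  then show False using assms uncountable_open_interval by blast
qed

lemma frequently_isCont_cdf: "frequently (isCont (cdf M)) (at_right a)"
  unfolding frequently_def eventually_at_right_field
  using ex_isCont_cdf_between by blast

text \<open>The difference of the distribution functions is right-continuous, so a nonzero value at
  \<open>a\<close> would persist on an interval to the right of \<open>a\<close>. Such an interval
  contains a continuity point.\<close>

lemma cdf_eqI_isCont:
  assumes r: "real_distribution N" and eq: "\<And>x. isCont (cdf M) x \<Longrightarrow> cdf M x = cdf N x"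
  shows "M = N"
proof (rule cdf_unique[OF real_distribution_axioms r], rule ext, rule ccontr)
  interpret N: real_distribution N by fact
  fix a assume ne: "cdf M a \<noteq> cdf N a"
  have "((\<lambda>x. cdf M x - cdf N x) \<longlongrightarrow> cdf M a - cdf N a) (at_right a)"
    using cdf_is_right_cont[of a] N.cdf_is_right_cont[of a]
    by (intro tendsto_diff) (auto simp: continuous_within)
  then have "eventually (\<lambda>x. cdf M x - cdf N x \<noteq> 0) (at_right a)"
    using ne by (intro tendsto_imp_eventually_ne) auto
  then have "eventually (\<lambda>x. \<not> isCont (cdf M) x) (at_right a)"
    by (rule eventually_mono) (use eq in auto)
  then show False using frequently_isCont_cdf[of a] by (simp add: frequently_def)
qed

text \<open>Otherwise the distribution function takes only the values 0 and 1, hence is a single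
  unit step, and all mass sits at the point of the step.\<close>

lemma ex_cdf_strictly_between:
  assumes nondeg: "\<And>c. measure M {c} \<noteq> 1"
  shows "\<exists>x. isCont (cdf M) x \<and> 0 < cdf M x \<and> cdf M x < 1"
proof (rule ccontr)
  assume "\<not> ?thesis"
  then have ct: "cdf M x = 0 \<or> cdf M x = 1" if "isCont (cdf M) x" for x
    using that cdf_nonneg[of x] cdf_bounded_prob[of x] by force
  \<comment> \<open>Right-continuity extends the dichotomy from continuity points to all
    points.\<close>
  have zo: "cdf M x = 0 \<or> cdf M x = 1" for x
  proof (rule ccontr)
    assume "\<not> ?thesis"
    moreover have "(cdf M \<longlongrightarrow> cdf M x) (at_right x)"
      using cdf_is_right_cont[of x] by (simp add: continuous_within)
    ultimately have "eventually (\<lambda>y. cdf M y \<noteq> 0 \<and> cdf M y \<noteq> 1) (at_right x)"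
      by (intro eventually_conj tendsto_imp_eventually_ne) auto
    then have "eventually (\<lambda>y. \<not> isCont (cdf M) y) (at_right x)"
      by (rule eventually_mono) (use ct in auto)
    then show False using frequently_isCont_cdf[of x] by (simp add: frequently_def)
  qed
  let ?A = "{x. cdf M x = 1}"
  have "eventually (\<lambda>x. cdf M x > 0) at_top"
    by (rule order_tendstoD(1)[OF cdf_lim_at_top_prob]) simp
  then obtain x1 where "cdf M x1 > 0" by (auto simp: eventually_at_top_linorder)
  then have ne: "?A \<noteq> {}" using zo[of x1] by auto
  have "eventually (\<lambda>x. cdf M x < 1) at_bot"
    by (rule order_tendstoD(2)[OF cdf_lim_at_bot]) simp
  then obtain x0 where x0: "cdf M x0 < 1" by (auto simp: eventually_at_bot_linorder)
  have bdd: "bdd_below ?A"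
  proof (rule bdd_belowI[of _ x0])
    fix x assume "x \<in> ?A"
    then show "x0 \<le> x" using x0 cdf_nondecreasing[of x x0] by (cases "x0 \<le> x") auto
  qed
  define c where "c = Inf ?A"
  have lt: "cdf M x = 0" if "x < c" for x
    using zo[of x] cInf_lower[of x ?A] bdd that by (auto simp: c_def)
  have gt: "cdf M x = 1" if x: "c < x" for x
  proof -
    obtain y where "cdf M y = 1" "y < x" using cInf_lessD[OF ne, of x] x unfolding c_def by auto
    then show ?thesis using cdf_nondecreasing[of y x] zo[of x] by auto
  qed
  \<comment> \<open>The right limit shows that {..c} has mass 1, the left limit that {..<c} has mass
    0; the difference is the atom at c.\<close>
  have "(cdf M \<longlongrightarrow> cdf M c) (at_right c)"
    using cdf_is_right_cont[of c] by (simp add: continuous_within)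
  moreover have "(cdf M \<longlongrightarrow> 1) (at_right c)"
    by (rule tendsto_eventually) (auto simp: eventually_at_right_field gt intro!: exI[of _ "c + 1"])
  ultimately have "measure M {..c} = 1"
    unfolding cdf_def2[symmetric] by (rule tendsto_unique[OF trivial_limit_at_right_real])
  moreover have "(cdf M \<longlongrightarrow> 0) (at_left c)"
    by (rule tendsto_eventually) (auto simp: eventually_at_left_field lt intro!: exI[of _ "c - 1"])
  then have "measure M {..<c} = 0"
    using cdf_at_left[of c] by (rule tendsto_unique[OF trivial_limit_at_left_real, rotated])
  moreover have "measure M {..c} = measure M {..<c} + measure M {c}"
    using finite_measure_Union[of "{..<c}" "{c}"] unfolding ivl_disj_un_singleton by simp
  ultimately show False using nondeg[of c] by simp
qed

text \<open>\<open>A\<close> and \<open>B\<close> agree up to a small shift of the level and a small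
  additive error. Continuity of the distribution function at u absorbs the shift: it suffices to
  know the limit of \<open>A\<close> at continuity points v close to u.\<close>

lemma tendsto_compl_cdf_transfer:
  fixes A B :: "real \<Rightarrow> 'i \<Rightarrow> real"
  assumes AB: "\<And>u v \<delta>. u < v \<Longrightarrow> 0 < \<delta> \<Longrightarrow> eventually (\<lambda>i. A v i \<le> B u i + \<delta>) F"
    and BA: "\<And>u v \<delta>. u < v \<Longrightarrow> 0 < \<delta> \<Longrightarrow> eventually (\<lambda>i. B v i \<le> A u i + \<delta>) F"
    and A: "\<And>u. isCont (cdf M) u \<Longrightarrow> (A u \<longlongrightarrow> 1 - cdf M u) F"
    and u: "isCont (cdf M) u"
  shows "(B u \<longlongrightarrow> 1 - cdf M u) F"
proof (rule order_tendstoI)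
  fix a assume a: "a < 1 - cdf M u"
  have "eventually (\<lambda>x. cdf M x < 1 - a) (at_right u)"
    using u a by (intro order_tendstoD(2)) (auto simp: isCont_def filterlim_at_split)
  then obtain b where b: "u < b" "\<And>x. u < x \<Longrightarrow> x < b \<Longrightarrow> cdf M x < 1 - a"
    by (auto simp: eventually_at_right_field)
  then obtain v where v: "u < v" "isCont (cdf M) v" "cdf M v < 1 - a"
    using ex_isCont_cdf_between[of u b] by blast
  \<comment> \<open>Half of the gap between \<open>a\<close> and the limit of \<open>A v\<close>:
    one half keeps \<open>A v\<close> above a + \<delta>, the other pays for the error in
    \<open>AB\<close>.\<close>
  define \<delta> where "\<delta> = (1 - cdf M v - a) / 2"
  have "\<delta> > 0" using v by (simp add: \<delta>_def)
  have "eventually (\<lambda>i. a + \<delta> < A v i) F"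
    using v by (intro order_tendstoD(1)[OF A[OF v(2)]]) (simp add: \<delta>_def field_simps)
  with AB[OF v(1) \<open>\<delta> > 0\<close>] show "eventually (\<lambda>i. a < B u i) F"
    by eventually_elim simp
next
  fix a assume a: "1 - cdf M u < a"
  have "eventually (\<lambda>x. 1 - a < cdf M x) (at_left u)"
    using u a by (intro order_tendstoD(1)) (auto simp: isCont_def filterlim_at_split)
  then obtain b where b: "b < u" "\<And>x. b < x \<Longrightarrow> x < u \<Longrightarrow> 1 - a < cdf M x"
    by (auto simp: eventually_at_left_field)
  then obtain v where v: "v < u" "isCont (cdf M) v" "1 - a < cdf M v"
    using ex_isCont_cdf_between[of b u] by blast
  define \<delta> where "\<delta> = (a - (1 - cdf M v)) / 2"
  have "\<delta> > 0" using v by (simp add: \<delta>_def)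
  have "eventually (\<lambda>i. A v i < a - \<delta>) F"
    using v by (intro order_tendstoD(2)[OF A[OF v(2)]]) (simp add: \<delta>_def field_simps)
  with BA[OF v(1) \<open>\<delta> > 0\<close>] show "eventually (\<lambda>i. B u i < a) F"
    by eventually_elim simp
qed

end

lemma real_distribution_exponential_law: "0 < \<gamma> \<Longrightarrow> real_distribution (exponential_law \<gamma>)"
  unfolding exponential_law_def real_distribution_def real_distribution_axioms_def
  by (simp add: prob_space_exponential_density)

lemma cdf_exponential_law_nonpos:
  assumes "0 < \<gamma>" "x \<le> 0"
  shows "cdf (exponential_law \<gamma>) x = 0"
proof -
  interpret real_distribution "exponential_law \<gamma>"
    by (rule real_distribution_exponential_law) fact
  show ?thesis
    using cdf_exponential_law[OF assms(1), of 0] cdf_nondecreasing[OF assms(2)] cdf_nonneg[of x] by simp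
qed

section \<open>Laplace transforms and tails of a subordinator\<close>

locale positive_subordinator_slowly_varying = subordinator M Y + decr_slowly_varying L
  for M :: "'a measure" and Y :: "real \<Rightarrow> 'a \<Rightarrow> real" and L :: "real \<Rightarrow> real" +
  fixes \<Phi> :: "real \<Rightarrow> real"
  assumes Y_pos: "0 < t \<Longrightarrow> \<omega> \<in> space M \<Longrightarrow> 0 < Y t \<omega>"
    and laplace: "laplace_exponent M Y \<Phi>"
begin

text \<open>For t > 0 this is the Laplace transform of \<open>Y t\<close> at the reciprocal of the
  inverse of \<open>L\<close> at level u / t. Its negative logarithm is the expression in the fourth
  statement.\<close>

definition transform :: "real \<Rightarrow> real \<Rightarrow> real" where
  "transform u t = exp (- (t * \<Phi> (recip_inverse L (u / t))))"

definition tail :: "real \<Rightarrow> real \<Rightarrow> real" where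
  "tail u t = prob {\<omega>\<in>space M. u < t * L (Y t \<omega>)}"

section \<open>Measurability and elementary bounds for the Laplace transform\<close>

lemma Y_measurable [measurable]: "0 < t \<Longrightarrow> Y t \<in> borel_measurable M"
  by (simp add: random_variable_at)

text \<open>\<open>L\<close> is known to be monotone on the positive half-line only, so it is
  measurable as a function on that subspace, into which \<open>Y t\<close> maps.\<close>

lemma L_Y_measurable [measurable]:
  assumes t: "0 < t"
  shows "(\<lambda>\<omega>. L (Y t \<omega>)) \<in> borel_measurable M"
proof -
  have "mono_on {0<..} (\<lambda>x. - L x)" using L_le by (auto intro!: monotone_onI)
  then have "(\<lambda>x. - (- L x)) \<in> borel_measurable (restrict_space borel {0<..})"
    by (intro borel_measurable_uminus borel_measurable_mono_on_fnc)
  then have "L \<in> borel_measurable (restrict_space borel {0<..})" by simp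
  moreover have "Y t \<in> measurable M (restrict_space borel {0<..})"
    using t by (intro measurable_restrict_space2) (auto simp: Y_pos)
  ultimately show ?thesis by (rule measurable_compose[rotated])
qed

lemma integral_exp: "0 < t \<Longrightarrow> 0 \<le> u \<Longrightarrow> (\<integral>\<omega>. exp (- u * Y t \<omega>) \<partial>M) = exp (- t * \<Phi> u)"
  using laplace unfolding laplace_exponent_def by simp

lemma integrable_exp: "0 < t \<Longrightarrow> 0 \<le> u \<Longrightarrow> integrable M (\<lambda>\<omega>. exp (- u * Y t \<omega>))"
  by (intro integrable_const_bound[where B=1]) (auto intro!: AE_I2 mult_nonneg_nonneg less_imp_le[OF Y_pos])

lemma \<Phi>_0 [simp]: "\<Phi> 0 = 0"
  using integral_exp[of 1 0] prob_space by simp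

text \<open>At time 1 the Laplace transform exp (- \<Phi>(u)) is decreasing in u, because
  \<open>Y 1\<close> is positive.\<close>

lemma \<Phi>_mono:
  assumes "0 \<le> u" "u \<le> v"
  shows "\<Phi> u \<le> \<Phi> v"
proof -
  have "(\<integral>\<omega>. exp (- v * Y 1 \<omega>) \<partial>M) \<le> (\<integral>\<omega>. exp (- u * Y 1 \<omega>) \<partial>M)"
    using assms Y_pos[of 1] by (intro integral_mono integrable_exp) (auto intro!: mult_right_mono less_imp_le)
  then show ?thesis using assms integral_exp[of 1 u] integral_exp[of 1 v] by simp
qed

lemma \<Phi>_nonneg: "0 \<le> u \<Longrightarrow> 0 \<le> \<Phi> u"
  using \<Phi>_mono[of 0 u] by simp

text \<open>Split the expectation according to whether r Y\<le>K fails: the integrand is at most exp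
  (-K) where r times \<open>Y t\<close> is at least K, and at most 1 elsewhere. Useful for large
  K.\<close>

lemma exp_\<Phi>_le:
  assumes "0 < t" "0 \<le> r"
  shows "exp (- (t * \<Phi> r)) \<le> exp (- K) + prob {\<omega>\<in>space M. r * Y t \<omega> < K}"
proof -
  let ?A = "{\<omega>\<in>space M. r * Y t \<omega> < K}"
  have [measurable]: "?A \<in> sets M" using assms by measurable
  have "exp (- (t * \<Phi> r)) = (\<integral>\<omega>. exp (- r * Y t \<omega>) \<partial>M)"
    using integral_exp[OF assms] by simp
  also have "\<dots> \<le> (\<integral>\<omega>. exp (- K) + indicator ?A \<omega> \<partial>M)"
  proof (intro integral_mono integrable_exp assms)
    fix \<omega> assume \<omega>: "\<omega> \<in> space M"
    show "exp (- r * Y t \<omega>) \<le> exp (- K) + indicator ?A \<omega>"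
    proof (cases "r * Y t \<omega> < K")
      case True
      have "exp (- r * Y t \<omega>) \<le> 1" using assms Y_pos[OF assms(1) \<omega>] by simp
      also have "\<dots> \<le> exp (- K) + 1" by simp
      finally show ?thesis using True \<omega> by (simp add: indicator_def)
    qed (simp add: indicator_def)
  qed (auto simp: less_top[symmetric])
  also have "\<dots> = exp (- K) + prob ?A"
    by (subst Bochner_Integration.integral_add) (auto simp: prob_space less_top[symmetric])
  finally show ?thesis .
qed

text \<open>Markov's inequality for the exponential: on the event the integrand is at least exp
  (-K). Useful for small K, where this factor is close to 1.\<close>

lemma le_exp_\<Phi>:
  assumes "0 < t" "0 \<le> r"
  shows "exp (- K) * prob {\<omega>\<in>space M. r * Y t \<omega> \<le> K} \<le> exp (- (t * \<Phi> r))"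
proof -
  let ?A = "{\<omega>\<in>space M. r * Y t \<omega> \<le> K}"
  have [measurable]: "?A \<in> sets M" using assms by measurable
  have "exp (- K) * prob ?A = (\<integral>\<omega>. exp (- K) * indicator ?A \<omega> \<partial>M)" by simp
  also have "\<dots> \<le> (\<integral>\<omega>. exp (- r * Y t \<omega>) \<partial>M)"
  proof (intro integral_mono integrable_exp assms)
    show "integrable M (\<lambda>\<omega>. exp (- K) * indicator ?A \<omega>)" by (simp add: less_top[symmetric])
    show "exp (- K) * indicator ?A \<omega> \<le> exp (- r * Y t \<omega>)" for \<omega> by (simp add: indicator_def)
  qed
  also have "\<dots> = exp (- (t * \<Phi> r))" using integral_exp[OF assms] by simp
  finally show ?thesis .
qed

section \<open>Levels u \<le> 0, where transform and tail both tend to 1\<close>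

lemma transform_le_1: "0 < t \<Longrightarrow> transform u t \<le> 1"
  by (simp add: transform_def \<Phi>_nonneg recip_inverse_nonneg)

lemma tail_le_1: "tail u t \<le> 1"
  by (simp add: tail_def)

text \<open>The levels u / t stay \<le> 0, so the arguments of \<open>\<Phi>\<close> are bounded by
  a fixed r, and t \<Phi>(r) tends to 0.\<close>

lemma transform_nonpos_tendsto:
  assumes "u \<le> 0"
  shows "(transform u \<longlongrightarrow> 1) (at_right 0)"
proof -
  obtain r where r: "\<And>x. x \<le> 0 \<Longrightarrow> recip_inverse L x \<le> r" using recip_inverse_bounded by blast
  show ?thesis
  proof (rule tendsto_sandwich)
    have "((\<lambda>t. exp (- (t * \<Phi> r))) \<longlongrightarrow> exp (- (0 * \<Phi> r))) (at_right 0)" by (intro tendsto_intros)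
    then show "((\<lambda>t. exp (- (t * \<Phi> r))) \<longlongrightarrow> 1) (at_right 0)" by simp
    show "eventually (\<lambda>t. exp (- (t * \<Phi> r)) \<le> transform u t) (at_right 0)"
      using eventually_at_right_less[of 0]
    proof eventually_elim
      case (elim t)
      then have "u / t \<le> 0" using assms by (simp add: divide_le_0_iff)
      then have "\<Phi> (recip_inverse L (u / t)) \<le> \<Phi> r" using r recip_inverse_nonneg by (intro \<Phi>_mono) auto
      then show ?case using elim by (simp add: transform_def)
    qed
    show "eventually (\<lambda>t. transform u t \<le> 1) (at_right 0)"
      using eventually_at_right_less[of 0] by eventually_elim (rule transform_le_1)
  qed simp
qed

text \<open>\<open>Y t\<close> tends to 0 in probability, and near zero \<open>L\<close> is
  positive, hence t L exceeds u \<le> 0 there.\<close>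

lemma tail_nonpos_tendsto:
  assumes "u \<le> 0"
  shows "(tail u \<longlongrightarrow> 1) (at_right 0)"
proof (rule order_tendstoI)
  fix a :: real assume "1 < a"
  then show "eventually (\<lambda>t. tail u t < a) (at_right 0)"
    using tail_le_1 by (intro always_eventually) (auto intro: order.strict_trans1)
next
  fix a :: real assume a: "a < 1"
  obtain d where d: "0 < d" "\<And>y. 0 < y \<Longrightarrow> y < d \<Longrightarrow> 0 < L y" using ex_pos_near_zero[of 0] by blast
  \<comment> \<open>Makes exp (-K) at most (1 - a)/2; once the Laplace transform exceeds (1 + a)/2,
    a probability above a remains. The maximum with 1 keeps K positive.\<close>
  define K where "K = max 1 (- ln ((1 - a) / 2))"
  have "exp (- K) \<le> exp (- (- ln ((1 - a) / 2)))" unfolding K_def by (subst exp_le_cancel_iff) simp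
  also have "\<dots> = (1 - a) / 2" using a by simp
  finally have K: "exp (- K) \<le> (1 - a) / 2" "0 < K" by (auto simp: K_def)
  have "((\<lambda>t. exp (- (t * \<Phi> (K / d)))) \<longlongrightarrow> exp (- (0 * \<Phi> (K / d)))) (at_right 0)"
    by (intro tendsto_intros)
  then have "eventually (\<lambda>t. (1 + a) / 2 < exp (- (t * \<Phi> (K / d)))) (at_right 0)"
    using a by (intro order_tendstoD(1)) auto
  then show "eventually (\<lambda>t. a < tail u t) (at_right 0)"
    using eventually_at_right_less[of 0]
  proof eventually_elim
    case (elim t)
    \<comment> \<open>With r = K / d the event of \<open>exp_\<Phi>_le\<close> is that
      \<open>Y t\<close> lies below d, the range where \<open>L\<close> is positive.\<close>
    have "prob {\<omega>\<in>space M. K / d * Y t \<omega> < K} \<le> tail u t"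
      unfolding tail_def
    proof (rule finite_measure_mono; (rule subsetI; clarsimp)?)
      show "{\<omega> \<in> space M. u < t * L (Y t \<omega>)} \<in> events" using elim by measurable
      fix \<omega> assume \<omega>: "\<omega> \<in> space M" "K * Y t \<omega> / d < K"
      then have "K * Y t \<omega> < K * d" using d(1) by (simp add: field_simps)
      then have "Y t \<omega> < d" using K(2) by simp
      then have "0 < t * L (Y t \<omega>)" using elim d(2) Y_pos \<omega> by simp
      then show "u < t * L (Y t \<omega>)" using assms by simp
    qed
    then show ?case using exp_\<Phi>_le[of t "K / d" K] elim K d(1) by (simp add: field_simps)
  qed
qed

section \<open>Comparison of transform and tail\<close>

lemma filterlim_divide_at_right: "0 < u \<Longrightarrow> filterlim (\<lambda>t. u / t) at_top (at_right (0::real))"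
  unfolding divide_inverse
  by (intro filterlim_tendsto_pos_mult_at_top[OF tendsto_const _ filterlim_inverse_at_top_right])

lemma scaled_L_ginv_tendsto:
  assumes "0 < u" "0 < c"
  shows "((\<lambda>t. t * L (c * ginv L (u / t))) \<longlongrightarrow> u) (at_right 0)"
proof -
  have "((\<lambda>t. u * (L (c * ginv L (u / t)) / (u / t))) \<longlongrightarrow> u * 1) (at_right 0)"
    by (intro tendsto_mult tendsto_const filterlim_compose[OF L_ginv_asymp filterlim_divide_at_right] assms)
  then show ?thesis using assms by (simp add: mult.commute)
qed

text \<open>Let s be the inverse at level v / t. Where \<open>Y t\<close> is below K s, t
  L(\<open>Y t\<close>) is at least t L(K s), which tends to v > u; so this event lies in the tail
  event at u. The rest contributes at most exp (-K). For u \<le> 0 the tail itself tends to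
  1.\<close>

lemma eventually_transform_le_tail:
  assumes uv: "u < v" and \<delta>: "0 < \<delta>"
  shows "eventually (\<lambda>t. transform v t \<le> tail u t + \<delta>) (at_right 0)"
proof (cases "u \<le> 0")
  case True
  then have "eventually (\<lambda>t. 1 - \<delta> < tail u t) (at_right 0)"
    using \<delta> by (intro order_tendstoD(1)[OF tail_nonpos_tendsto]) auto
  with eventually_at_right_less[of 0] show ?thesis
  proof eventually_elim
    case (elim t)
    then show ?case using transform_le_1[of t v] by simp
  qed
next
  case False
  then have u: "0 < u" and v: "0 < v" using uv by auto
  \<comment> \<open>Chosen so that exp (-K) \<le> \<delta> and K > 0.\<close>
  define K where "K = max 1 (- ln \<delta>)"
  have "exp (- K) \<le> exp (- (- ln \<delta>))" unfolding K_def by (subst exp_le_cancel_iff) simp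
  then have K: "exp (- K) \<le> \<delta>" "0 < K" using \<delta> by (auto simp: K_def)
  have "eventually (\<lambda>t. u < t * L (K * ginv L (v / t))) (at_right 0)"
    by (rule order_tendstoD(1)[OF scaled_L_ginv_tendsto]) (use v uv K in auto)
  moreover have "eventually (\<lambda>t. at_infty L < ereal (v / t)) (at_right 0)"
    using eventually_at_infty_less filterlim_divide_at_right[OF v] by (rule eventually_compose_filterlim)
  ultimately show ?thesis using eventually_at_right_less[of 0]
  proof eventually_elim
    case (elim t)
    let ?s = "ginv L (v / t)"
    have s: "0 < ?s" using elim by (intro ginv_pos) auto
    have "prob {\<omega>\<in>space M. 1 / ?s * Y t \<omega> < K} \<le> tail u t"
      unfolding tail_def
    proof (rule finite_measure_mono; (rule subsetI; clarsimp)?)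
      show "{\<omega> \<in> space M. u < t * L (Y t \<omega>)} \<in> events" using elim by measurable
      fix \<omega> assume \<omega>: "\<omega> \<in> space M" "Y t \<omega> / ?s < K"
      then have "Y t \<omega> \<le> K * ?s" using s by (simp add: field_simps)
      then have "L (K * ?s) \<le> L (Y t \<omega>)" using \<omega> elim Y_pos by (intro L_le) auto
      then have "t * L (K * ?s) \<le> t * L (Y t \<omega>)" using elim by simp
      with elim(1) show "u < t * L (Y t \<omega>)" by (rule less_le_trans)
    qed
    then show ?case using exp_\<Phi>_le[of t "1 / ?s" K] elim K s
      by (simp add: transform_def recip_inverse_eq)
  qed
qed

text \<open>With s the inverse at level u / t, t L(\<delta> s) tends to u < v, so the tail event at
  v forces \<open>Y t\<close> \<le> \<delta> s. There the integrand of the Laplace transform is at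
  least exp (-\<delta>).\<close>

lemma eventually_tail_le_transform:
  assumes uv: "u < v" and \<delta>: "0 < \<delta>"
  shows "eventually (\<lambda>t. tail v t \<le> transform u t + \<delta>) (at_right 0)"
proof (cases "u \<le> 0")
  case True
  then have "eventually (\<lambda>t. 1 - \<delta> < transform u t) (at_right 0)"
    using \<delta> by (intro order_tendstoD(1)[OF transform_nonpos_tendsto]) auto
  then show ?thesis
  proof eventually_elim
    case (elim t)
    then show ?case using tail_le_1[of v t] by simp
  qed
next
  case False
  then have u: "0 < u" by auto
  have "eventually (\<lambda>t. t * L (\<delta> * ginv L (u / t)) < v) (at_right 0)"
    by (rule order_tendstoD(2)[OF scaled_L_ginv_tendsto]) (use u uv \<delta> in auto)
  moreover have "eventually (\<lambda>t. at_infty L < ereal (u / t)) (at_right 0)"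
    using eventually_at_infty_less filterlim_divide_at_right[OF u] by (rule eventually_compose_filterlim)
  ultimately show ?thesis using eventually_at_right_less[of 0]
  proof eventually_elim
    case (elim t)
    let ?s = "ginv L (u / t)" and ?P = "prob {\<omega>\<in>space M. 1 / ginv L (u / t) * Y t \<omega> \<le> \<delta>}"
    have s: "0 < ?s" using elim by (intro ginv_pos) auto
    have "tail v t \<le> ?P"
      unfolding tail_def
    proof (rule finite_measure_mono; (rule subsetI; clarsimp)?)
      show "{\<omega> \<in> space M. 1 / ?s * Y t \<omega> \<le> \<delta>} \<in> events" using elim by measurable
      fix \<omega> assume \<omega>: "\<omega> \<in> space M" "v < t * L (Y t \<omega>)"
      show "Y t \<omega> / ?s \<le> \<delta>"
      proof (rule ccontr)
        assume "\<not> Y t \<omega> / ?s \<le> \<delta>"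
        then have "\<delta> * ?s \<le> Y t \<omega>" using s by (simp add: field_simps)
        then have "L (Y t \<omega>) \<le> L (\<delta> * ?s)" using s \<delta> by (intro L_le) auto
        then have "t * L (Y t \<omega>) \<le> t * L (\<delta> * ?s)" using elim by simp
        also note elim(1)
        finally show False using \<omega> by simp
      qed
    qed
    \<comment> \<open>The first part is bounded by the Laplace transform; the second is at most 1 -
      exp (-\<delta>) \<le> \<delta>.\<close>
    also have "?P = exp (- \<delta>) * ?P + (1 - exp (- \<delta>)) * ?P" by (simp add: algebra_simps)
    also have "\<dots> \<le> transform u t + (1 - exp (- \<delta>)) * 1"
      using le_exp_\<Phi>[of t "1 / ?s" \<delta>] elim \<delta> s
      by (intro add_mono mult_left_mono) (auto simp: transform_def recip_inverse_eq)
    also have "\<dots> \<le> transform u t + \<delta>" using exp_ge_add_one_self[of "- \<delta>"] by simp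
    finally show ?case .
  qed
qed

section \<open>Convergence in distribution and asymptotics of the Laplace exponent\<close>

lemma cdf_scaled_L: "0 < t \<Longrightarrow> cdf (distr M borel (\<lambda>\<omega>. t * L (Y t \<omega>))) u = 1 - tail u t"
proof -
  assume t: "0 < t"
  have "cdf (distr M borel (\<lambda>\<omega>. t * L (Y t \<omega>))) u = prob {\<omega>\<in>space M. t * L (Y t \<omega>) \<le> u}"
    using t by (simp add: cdf_def measure_distr vimage_def Int_def conj_commute)
  also have "\<dots> = 1 - tail u t"
    unfolding tail_def using t by (subst prob_neg[symmetric]) (auto simp: not_less)
  finally show ?thesis .
qed

lemma converges_in_distribution_iff_tail:
  "converges_in_distribution M (\<lambda>t \<omega>. t * L (Y t \<omega>)) \<mu> (at_right 0) \<longleftrightarrow>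
    (\<forall>u. isCont (cdf \<mu>) u \<longrightarrow> (tail u \<longlongrightarrow> 1 - cdf \<mu> u) (at_right 0))"
proof -
  have "((\<lambda>t. cdf (distr M borel (\<lambda>\<omega>. t * L (Y t \<omega>))) u) \<longlongrightarrow> p) (at_right 0) \<longleftrightarrow>
      (tail u \<longlongrightarrow> 1 - p) (at_right 0)" for u p
  proof -
    have "((\<lambda>t. cdf (distr M borel (\<lambda>\<omega>. t * L (Y t \<omega>))) u) \<longlongrightarrow> p) (at_right 0) \<longleftrightarrow>
        ((\<lambda>t. 1 - tail u t) \<longlongrightarrow> p) (at_right 0)"
      by (rule tendsto_cong, rule eventually_mono[OF eventually_at_right_less[of 0]]) (simp add: cdf_scaled_L)
    also have "\<dots> \<longleftrightarrow> (tail u \<longlongrightarrow> 1 - p) (at_right 0)"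
      using tendsto_diff[OF tendsto_const[of 1], of "\<lambda>t. 1 - tail u t" p]
        tendsto_diff[OF tendsto_const[of 1], of "tail u" "1 - p"] by auto
    finally show ?thesis .
  qed
  then show ?thesis by (simp add: converges_in_distribution_def)
qed

text \<open>The two comparison lemmas have the same shape with \<open>tail\<close> and
  \<open>transform\<close> exchanged, so the transfer lemma applies in both directions.\<close>

lemma converges_in_distribution_iff_transform:
  assumes "real_distribution \<mu>"
  shows "converges_in_distribution M (\<lambda>t \<omega>. t * L (Y t \<omega>)) \<mu> (at_right 0) \<longleftrightarrow>
    (\<forall>u. isCont (cdf \<mu>) u \<longrightarrow> (transform u \<longlongrightarrow> 1 - cdf \<mu> u) (at_right 0))"
proof -
  interpret \<mu>: real_distribution \<mu> by fact
  show ?thesis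
    unfolding converges_in_distribution_iff_tail
  proof (intro iffI allI impI)
    fix u assume *: "\<forall>u. isCont (cdf \<mu>) u \<longrightarrow> (tail u \<longlongrightarrow> 1 - cdf \<mu> u) (at_right 0)" "isCont (cdf \<mu>) u"
    show "(transform u \<longlongrightarrow> 1 - cdf \<mu> u) (at_right 0)"
      by (rule \<mu>.tendsto_compl_cdf_transfer[where A=tail and B=transform])
        (use * eventually_transform_le_tail eventually_tail_le_transform in auto)
  next
    fix u assume *: "\<forall>u. isCont (cdf \<mu>) u \<longrightarrow> (transform u \<longlongrightarrow> 1 - cdf \<mu> u) (at_right 0)" "isCont (cdf \<mu>) u"
    show "(tail u \<longlongrightarrow> 1 - cdf \<mu> u) (at_right 0)"
      by (rule \<mu>.tendsto_compl_cdf_transfer[where A=transform and B=tail])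
        (use * eventually_transform_le_tail eventually_tail_le_transform in auto)
  qed
qed

text \<open>Substituting s = \<open>ginv L x\<close> gives the limit along x from that along s, as
  L(s)/x tends to 1. This substitution need not reach every s, so the converse encloses \<Phi>(1/s)
  between values at nearby levels, by monotonicity of \<open>\<Phi>\<close>.\<close>

lemma tendsto_\<Phi>_recip_inverse_iff:
  "((\<lambda>x. \<Phi> (recip_inverse L x) / x) \<longlongrightarrow> \<gamma>) at_top \<longleftrightarrow>
    ((\<lambda>s. \<Phi> (1 / s) / L s) \<longlongrightarrow> \<gamma>) (at_right 0)" (is "(?f \<longlongrightarrow> \<gamma>) at_top \<longleftrightarrow> (?h \<longlongrightarrow> \<gamma>) (at_right 0)")
proof
  assume h: "(?h \<longlongrightarrow> \<gamma>) (at_right 0)"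
  have "((\<lambda>x. ?h (ginv L x) * (L (1 * ginv L x) / x)) \<longlongrightarrow> \<gamma> * 1) at_top"
    by (intro tendsto_mult filterlim_compose[OF h ginv_tendsto_0] L_ginv_asymp) simp
  moreover have "filterlim (\<lambda>x. L (ginv L x)) at_top at_top"
    by (rule filterlim_compose[OF at_top_at_zero ginv_tendsto_0])
  then have "eventually (\<lambda>x. 0 < L (ginv L x)) at_top" unfolding filterlim_at_top_dense by blast
  then have "eventually (\<lambda>x. ?h (ginv L x) * (L (1 * ginv L x) / x) = ?f x) at_top"
    using eventually_at_infty_less by eventually_elim (simp add: recip_inverse_eq)
  ultimately show "(?f \<longlongrightarrow> \<gamma>) at_top" unfolding mult_1_right by (rule Lim_transform_eventually)
next
  assume f: "(?f \<longlongrightarrow> \<gamma>) at_top"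
  have L_pos: "eventually (\<lambda>s. 0 < L s) (at_right 0)"
    using at_top_at_zero unfolding filterlim_at_top_dense by blast
  have cL: "filterlim (\<lambda>s. c * L s) at_top (at_right 0)" if "0 < c" for c
    by (rule filterlim_tendsto_pos_mult_at_top[OF tendsto_const that at_top_at_zero])
  \<comment> \<open>\<open>L\<close> may have flat pieces, so \<open>ginv L (L s)\<close> can be smaller than \<open>s\<close>; lowering the level to
    \<open>c * L s\<close> ensures \<open>s \<le> ginv L (c * L s)\<close>.\<close>
  have lb: "eventually (\<lambda>s. c * ?f (c * L s) \<le> ?h s) (at_right 0)" if c: "0 < c" "c < 1" for c
    using eventually_compose_filterlim[OF eventually_at_infty_less cL[OF c(1)]]
      L_pos eventually_at_right_less[of 0]
  proof eventually_elim
    case (elim s)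
    have "s \<le> ginv L (c * L s)"
    proof (rule le_ginv)
      fix y assume "0 < y" "y < s"
      then have "L s \<le> L y" by (intro L_le) auto
      moreover have "c * L s < L s" using c elim by simp
      ultimately show "c * L s < L y" by simp
    qed (use elim in auto)
    then have "recip_inverse L (c * L s) \<le> 1 / s"
      using elim by (simp add: recip_inverse_eq frac_le)
    then have "\<Phi> (recip_inverse L (c * L s)) \<le> \<Phi> (1 / s)"
      by (intro \<Phi>_mono recip_inverse_nonneg)
    then show ?case using c elim by (simp add: divide_right_mono)
  qed
  \<comment> \<open>The level L(s) itself suffices here, since its inverse is at most s. The factor
    1 fits the shape of \<open>cL\<close>.\<close>
  have ub: "eventually (\<lambda>s. ?h s \<le> ?f (1 * L s)) (at_right 0)"
    using eventually_compose_filterlim[OF eventually_at_infty_less at_top_at_zero]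
      L_pos eventually_at_right_less[of 0]
  proof eventually_elim
    case (elim s)
    have "1 / s \<le> recip_inverse L (L s)"
      using elim ginv_pos[of "L s"] ginv_le[of s L "L s"] by (simp add: recip_inverse_eq frac_le)
    then have "\<Phi> (1 / s) \<le> \<Phi> (recip_inverse L (L s))" using elim by (intro \<Phi>_mono) auto
    then show ?case using elim by (simp add: divide_right_mono)
  qed
  show "(?h \<longlongrightarrow> \<gamma>) (at_right 0)"
  proof (rule order_tendstoI)
    fix a assume "\<gamma> < a"
    then have "eventually (\<lambda>s. ?f (1 * L s) < a) (at_right 0)"
      by (intro order_tendstoD(2)[OF filterlim_compose[OF f cL]]) auto
    with ub show "eventually (\<lambda>s. ?h s < a) (at_right 0)" by eventually_elim simp
  next
    fix a assume a: "a < \<gamma>"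
    \<comment> \<open>The lower bound loses a factor c, so c < 1 is taken close enough to 1.\<close>
    have "((\<lambda>c. c * \<gamma>) \<longlongrightarrow> 1 * \<gamma>) (at_left 1)" by (intro tendsto_intros)
    then have "eventually (\<lambda>c. a < c * \<gamma>) (at_left 1)" using a by (intro order_tendstoD(1)) auto
    moreover have "eventually (\<lambda>c. (0::real) < c \<and> c < 1) (at_left 1)"
      by (auto simp: eventually_at_left_field intro!: exI[of _ 0])
    ultimately have "eventually (\<lambda>c. a < c * \<gamma> \<and> 0 < c \<and> c < 1) (at_left 1)"
      by (rule eventually_conj)
    then obtain c where c: "a < c * \<gamma>" "0 < c" "c < 1"
      using eventually_happens'[OF trivial_limit_at_left_real] by blast
    have "((\<lambda>s. c * ?f (c * L s)) \<longlongrightarrow> c * \<gamma>) (at_right 0)"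
      by (intro tendsto_mult tendsto_const filterlim_compose[OF f cL] c)
    then have "eventually (\<lambda>s. a < c * ?f (c * L s)) (at_right 0)"
      using c(1) by (rule order_tendstoD(1))
    with lb[OF c(2,3)] show "eventually (\<lambda>s. a < ?h s) (at_right 0)" by eventually_elim simp
  qed
qed

section \<open>Identification of the limit law\<close>

lemma transform_tendsto_iff:
  assumes "0 < u"
  shows "(transform u \<longlongrightarrow> p) (at_right 0) \<longleftrightarrow>
    ((\<lambda>x. exp (- (u * (\<Phi> (recip_inverse L x) / x)))) \<longlongrightarrow> p) at_top"
proof -
  let ?f = "\<lambda>x. exp (- (u * (\<Phi> (recip_inverse L x) / x)))"
  have *: "filterlim (\<lambda>x. u / x) (at_right 0) at_top"
    using filterlim_times_pos[OF filterlim_inverse_at_right_top assms, of 0]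
    by (simp add: divide_inverse)
  \<comment> \<open>With x = u / t, t \<Phi> becomes u \<Phi> / x. Thus one function of x governs
    all levels u > 0.\<close>
  have tr: "transform u t = ?f (u / t)" for t using assms by (simp add: transform_def)
  show ?thesis
  proof
    assume "(transform u \<longlongrightarrow> p) (at_right 0)"
    from filterlim_compose[OF this *] show "(?f \<longlongrightarrow> p) at_top"
      using assms unfolding tr by simp
  next
    assume "(?f \<longlongrightarrow> p) at_top"
    from filterlim_compose[OF this filterlim_divide_at_right[OF assms]]
    show "(transform u \<longlongrightarrow> p) (at_right 0)" unfolding tr .
  qed
qed

lemma converges_to_exponential_iff:
  assumes \<gamma>: "0 < \<gamma>"
  shows "converges_in_distribution M (\<lambda>t \<omega>. t * L (Y t \<omega>)) (exponential_law \<gamma>) (at_right 0) \<longleftrightarrow>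
    ((\<lambda>s. \<Phi> (1 / s) / L s) \<longlongrightarrow> \<gamma>) (at_right 0)"
proof -
  let ?f = "\<lambda>x. \<Phi> (recip_inverse L x) / x"
  interpret E: real_distribution "exponential_law \<gamma>" by (rule real_distribution_exponential_law) fact
  have "(transform u \<longlongrightarrow> 1 - cdf (exponential_law \<gamma>) u) (at_right 0)" if f: "(?f \<longlongrightarrow> \<gamma>) at_top" for u
  proof (cases "u \<le> 0")
    case True
    then show ?thesis using transform_nonpos_tendsto[of u] \<gamma> by (simp add: cdf_exponential_law_nonpos)
  next
    case False
    have "((\<lambda>x. exp (- (u * ?f x))) \<longlongrightarrow> exp (- (u * \<gamma>))) at_top" by (intro tendsto_intros f)
    then show ?thesis using False \<gamma> by (simp add: transform_tendsto_iff cdf_exponential_law mult.commute)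
  qed
  moreover have "(?f \<longlongrightarrow> \<gamma>) at_top"
    if *: "\<And>u. isCont (cdf (exponential_law \<gamma>)) u \<Longrightarrow> (transform u \<longlongrightarrow> 1 - cdf (exponential_law \<gamma>) u) (at_right 0)"
  proof -
    obtain u where u: "0 < u" "isCont (cdf (exponential_law \<gamma>)) u" using E.ex_isCont_cdf_between[of 0 1] by auto
    have "((\<lambda>x. exp (- (u * ?f x))) \<longlongrightarrow> exp (- (u * \<gamma>))) at_top"
      using *[OF u(2)] u \<gamma> by (simp add: transform_tendsto_iff cdf_exponential_law mult.commute)
    \<comment> \<open>Since the limit is nonzero, \<open>ln\<close> is continuous there, and a
      single u > 0 already determines the limit of \<open>?f\<close>.\<close>
    then have "((\<lambda>x. - ln (exp (- (u * ?f x))) * (1 / u)) \<longlongrightarrow> - ln (exp (- (u * \<gamma>))) * (1 / u)) at_top"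
      by (rule tendsto_mult[OF tendsto_minus[OF tendsto_ln] tendsto_const]) simp
    then show ?thesis using u(1) by simp
  qed
  ultimately show ?thesis
    unfolding converges_in_distribution_iff_transform[OF E.real_distribution_axioms] tendsto_\<Phi>_recip_inverse_iff[symmetric]
    by blast
qed

text \<open>One value of the distribution function strictly between 0 and 1 forces \<open>?f\<close>
  to converge; that limit then determines the values at all other continuity points.\<close>

lemma exponential_if_converges:
  assumes "real_distribution \<mu>" and nondeg: "\<And>c. measure \<mu> {c} \<noteq> 1"
    and conv: "converges_in_distribution M (\<lambda>t \<omega>. t * L (Y t \<omega>)) \<mu> (at_right 0)"
  shows "\<exists>\<gamma>>0. \<mu> = exponential_law \<gamma>"
proof -
  let ?f = "\<lambda>x. \<Phi> (recip_inverse L x) / x"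
  interpret \<mu>: real_distribution \<mu> by fact
  have tr: "(transform u \<longlongrightarrow> 1 - cdf \<mu> u) (at_right 0)" if "isCont (cdf \<mu>) u" for u
    using conv that unfolding converges_in_distribution_iff_transform[OF assms(1)] by blast
  have nonpos: "cdf \<mu> u = 0" if "isCont (cdf \<mu>) u" "u \<le> 0" for u
    using tendsto_unique[OF _ tr[OF that(1)] transform_nonpos_tendsto[OF that(2)]] by simp
  obtain u where u: "isCont (cdf \<mu>) u" "0 < cdf \<mu> u" "cdf \<mu> u < 1"
    using \<mu>.ex_cdf_strictly_between nondeg by blast
  have u0: "0 < u" using nonpos[of u] u by force
  \<comment> \<open>The solution of exp (- u \<gamma>) = 1 - \<open>cdf \<mu> u\<close>, positive
    because this value lies strictly between 0 and 1.\<close>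
  define \<gamma> where "\<gamma> = - ln (1 - cdf \<mu> u) * (1 / u)"
  have "0 < \<gamma>" using u u0 by (simp add: \<gamma>_def divide_neg_pos)
  have "((\<lambda>x. exp (- (u * ?f x))) \<longlongrightarrow> 1 - cdf \<mu> u) at_top"
    using tr[OF u(1)] u0 by (simp add: transform_tendsto_iff)
  then have "((\<lambda>x. - ln (exp (- (u * ?f x))) * (1 / u)) \<longlongrightarrow> \<gamma>) at_top"
    unfolding \<gamma>_def by (rule tendsto_mult[OF tendsto_minus[OF tendsto_ln] tendsto_const]) (use u in simp)
  then have f: "(?f \<longlongrightarrow> \<gamma>) at_top" using u0 by simp
  have "\<mu> = exponential_law \<gamma>"
  proof (rule \<mu>.cdf_eqI_isCont[OF real_distribution_exponential_law[OF \<open>0 < \<gamma>\<close>]])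
    fix x assume x: "isCont (cdf \<mu>) x"
    show "cdf \<mu> x = cdf (exponential_law \<gamma>) x"
    proof (cases "x \<le> 0")
      case True
      then show ?thesis using nonpos x \<open>0 < \<gamma>\<close> by (simp add: cdf_exponential_law_nonpos)
    next
      case False
      have "((\<lambda>y. exp (- (x * ?f y))) \<longlongrightarrow> 1 - cdf \<mu> x) at_top"
        using tr[OF x] False by (simp add: transform_tendsto_iff)
      moreover have "((\<lambda>y. exp (- (x * ?f y))) \<longlongrightarrow> exp (- (x * \<gamma>))) at_top" by (intro tendsto_intros f)
      ultimately have "1 - cdf \<mu> x = exp (- (x * \<gamma>))" by (rule tendsto_unique[OF trivial_limit_at_top_linorder])
      then show ?thesis using False \<open>0 < \<gamma>\<close> by (simp add: cdf_exponential_law mult.commute)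
    qed
  qed
  then show ?thesis using \<open>0 < \<gamma>\<close> by blast
qed

end

text \<open>A prescribed \<gamma> need not fit the law of \<open>X\<close>. Hence the first
  statement is matched with the existence of a \<gamma> that parametrises this law, while the second
  and third are equivalent for each fixed \<gamma>.\<close>

theorem theorem5p1:
  fixes M :: "'a measure" and Y :: "real \<Rightarrow> 'a \<Rightarrow> real"
    and N :: "'b measure" and X :: "'b \<Rightarrow> real"
    and \<Phi> L :: "real \<Rightarrow> real"
  assumes "subordinator M Y"
    and "\<And>t \<omega>. 0 < t \<Longrightarrow> \<omega> \<in> space M \<Longrightarrow> 0 < Y t \<omega>"
    and "laplace_exponent M Y \<Phi>"
    and "antimono_on {0<..} L"
    and "filterlim L at_top (at_right 0)"
    and "slowly_varying_at_zero L"
    and "prob_space N" and "X \<in> borel_measurable N"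
    and "\<not> (\<exists>c. AE \<omega> in N. X \<omega> = c)"
  shows
    "let H = cdf (distr N borel X);
         S1 = converges_in_distribution M (\<lambda>t \<omega>. t * L (Y t \<omega>)) (distr N borel X) (at_right 0);
         S2 = (\<lambda>\<gamma>. converges_in_distribution M (\<lambda>t \<omega>. t * L (Y t \<omega>)) (exponential_law \<gamma>) (at_right 0));
         S3 = (\<lambda>\<gamma>. ((\<lambda>s. \<Phi> (1 / s) / L s) \<longlongrightarrow> \<gamma>) (at_right 0));
         S4 = (\<forall>u. isCont H u \<longrightarrow>
                ((\<lambda>t. ereal (t * \<Phi> (real_of_ereal (1 / decr_inverse L (u / t)))))
                  \<longlongrightarrow> neg_log (1 - H u)) (at_right 0))
     in (S1 \<longleftrightarrow> (\<exists>\<gamma>>0. distr N borel X = exponential_law \<gamma> \<and> S2 \<gamma>)) \<and>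
        (S1 \<longleftrightarrow> (\<exists>\<gamma>>0. distr N borel X = exponential_law \<gamma> \<and> S3 \<gamma>)) \<and>
        (S1 \<longleftrightarrow> S4) \<and>
        (\<forall>\<gamma>>0. S2 \<gamma> \<longleftrightarrow> S3 \<gamma>)"
proof -
  interpret positive_subordinator_slowly_varying M Y L \<Phi>
  proof (rule positive_subordinator_slowly_varying.intro)
    show "subordinator M Y" by fact
    show "decr_slowly_varying L" using assms(4-6) by (rule decr_slowly_varying.intro)
    show "positive_subordinator_slowly_varying_axioms M Y \<Phi>"
      using assms(2,3) by (rule positive_subordinator_slowly_varying_axioms.intro)
  qed
  interpret N: prob_space N by fact
  let ?\<mu> = "distr N borel X"
  let ?conv = "\<lambda>\<mu>. converges_in_distribution M (\<lambda>t \<omega>. t * L (Y t \<omega>)) \<mu> (at_right 0)"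
  let ?S4 = "\<forall>u. isCont (cdf ?\<mu>) u \<longrightarrow>
    ((\<lambda>t. ereal (t * \<Phi> (real_of_ereal (1 / decr_inverse L (u / t)))))
      \<longlongrightarrow> neg_log (1 - cdf ?\<mu> u)) (at_right 0)"
  have \<mu>: "real_distribution ?\<mu>" using assms(8) by simp
  then interpret \<mu>: real_distribution ?\<mu> .
  have nondeg: "measure ?\<mu> {c} \<noteq> 1" for c
  proof
    assume "measure ?\<mu> {c} = 1"
    then have "measure N {\<omega>\<in>space N. X \<omega> = c} = 1"
      using assms(8) by (simp add: measure_distr vimage_def Int_def conj_commute)
    then have "AE \<omega> in N. X \<omega> = c" using assms(8) by (simp add: N.AE_in_set_eq_1 N.prob_Collect_eq_1)
    then show False using assms(9) by blast
  qed
  have expo: "\<exists>\<gamma>>0. ?\<mu> = exponential_law \<gamma>" if "?conv ?\<mu>"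
    using exponential_if_converges[OF \<mu> nondeg that] .
  \<comment> \<open>\<open>exp_neg_tendsto_iff\<close> is applied with p = 1 - H(u), nonnegative by
    \<open>cdf_bounded_prob\<close>; H(u) = 1 gives the limit \<infinity>.\<close>
  have S4: "?conv ?\<mu> \<longleftrightarrow> ?S4"
    unfolding converges_in_distribution_iff_transform[OF \<mu>]
    using \<mu>.cdf_bounded_prob
    by (simp add: exp_neg_tendsto_iff transform_def[abs_def] recip_inverse_def)
  have S2: "?conv ?\<mu> \<longleftrightarrow> (\<exists>\<gamma>>0. ?\<mu> = exponential_law \<gamma> \<and> ?conv (exponential_law \<gamma>))"
  proof
    assume c: "?conv ?\<mu>"
    from expo[OF c] obtain \<gamma> where g: "0 < \<gamma>" "?\<mu> = exponential_law \<gamma>" by blast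
    from c have "?conv (exponential_law \<gamma>)" unfolding g(2) .
    with g show "\<exists>\<gamma>>0. ?\<mu> = exponential_law \<gamma> \<and> ?conv (exponential_law \<gamma>)"
      by (intro exI conjI)
  next
    assume "\<exists>\<gamma>>0. ?\<mu> = exponential_law \<gamma> \<and> ?conv (exponential_law \<gamma>)"
    then obtain \<gamma> where "?\<mu> = exponential_law \<gamma>" "?conv (exponential_law \<gamma>)" by (elim exE conjE)
    then show "?conv ?\<mu>" by (simp only:)
  qed
  also have "\<dots> \<longleftrightarrow> (\<exists>\<gamma>>0. ?\<mu> = exponential_law \<gamma> \<and>
      ((\<lambda>s. \<Phi> (1 / s) / L s) \<longlongrightarrow> \<gamma>) (at_right 0))"
    by (rule arg_cong[where f = Ex], rule ext) (simp only: converges_to_exponential_iff cong: conj_cong)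
  finally show ?thesis
    unfolding Let_def by (intro conjI allI impI S2 S4 converges_to_exponential_iff)
qed

end
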